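(* Let $c$ be a constant and let $\mathcal{G}$ be a class of graphs such that $\chi(G)\leq\omega(G)^c$ for every $G\in\mathcal{G}$. Then for every $G\in\mathcal{G}$ with $n$ vertices, \[\overset{\rightarrow}{\Gamma}_{LD}(G)\geq 2^{-c/(c+1)}\cdot n^{\frac{1}{c+1}}.\]
   Context: $\chi(G)$ is the chromatic number and $\omega(G)$ the clique number. For an orientation $D$ of a graph $G=(V,E)$ (each edge given exactly one direction), $S\subseteq V$ is locating-dominating in $D$ if every $u\notin S$ has an in-neighbour in $S$ and distinct $u,v\notin S$ have distinct sets of in-neighbours in $S$; $\gamma_{LD}(D)$ is the minimum size of such a set. $\overset{\rightarrow}{\Gamma}_{LD}(G)=\max_D\gamma_{LD}(D)$ over all orientations $D$ of $G$.
   Formalization: The constant c is taken to be a real number with c ≥ 0; for −1 < c < 0 the claim fails for edgeless graphs (c = −1/2 would require n ≥ 2n²), at c = −1 the exponent is undefined, and for c < −1 only edgeless graphs satisfy the hypothesis. *)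

theory Defs
  imports Complex_Main "Graph_Theory.Pair_Digraph"
begin

text \<open>
  A finite simple graph is a \<^locale>\<open>pair_graph\<close>: a finite loop-free symmetric digraph without
  parallel arcs, so the edge \<open>uv\<close> is the pair of arcs \<open>(u, v)\<close> and \<open>(v, u)\<close>.
\<close>

definition proper_colouring :: "'a pair_pre_digraph \<Rightarrow> nat \<Rightarrow> ('a \<Rightarrow> nat) \<Rightarrow> bool" where
  "proper_colouring G k f \<longleftrightarrow> f ` pverts G \<subseteq> {..<k} \<and> (\<forall>(u, v) \<in> parcs G. f u \<noteq> f v)"

definition chromatic_number :: "'a pair_pre_digraph \<Rightarrow> nat" where
  "chromatic_number G = (LEAST k. \<exists>f. proper_colouring G k f)"

definition clique :: "'a pair_pre_digraph \<Rightarrow> 'a set \<Rightarrow> bool" where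
  "clique G C \<longleftrightarrow> C \<subseteq> pverts G \<and> (\<forall>u\<in>C. \<forall>v\<in>C. u \<noteq> v \<longrightarrow> (u, v) \<in> parcs G)"

definition clique_number :: "'a pair_pre_digraph \<Rightarrow> nat" where
  "clique_number G = Max {card C | C. clique G C}"

text \<open>Every edge of \<open>G\<close> occurs in \<open>D\<close> in exactly one of its two directions.\<close>

definition orientation :: "'a pair_pre_digraph \<Rightarrow> 'a pair_pre_digraph \<Rightarrow> bool" where
  "orientation G D \<longleftrightarrow> pverts D = pverts G \<and>
     parcs D \<union> (parcs D)\<inverse> = parcs G \<and> parcs D \<inter> (parcs D)\<inverse> = {}"

definition in_nbrs :: "'a pair_pre_digraph \<Rightarrow> 'a \<Rightarrow> 'a set" where
  "in_nbrs D v = {u. (u, v) \<in> parcs D}"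

definition locating_dominating :: "'a pair_pre_digraph \<Rightarrow> 'a set \<Rightarrow> bool" where
  "locating_dominating D S \<longleftrightarrow> S \<subseteq> pverts D \<and>
     (\<forall>u \<in> pverts D - S. in_nbrs D u \<inter> S \<noteq> {}) \<and>
     (\<forall>u \<in> pverts D - S. \<forall>v \<in> pverts D - S. u \<noteq> v \<longrightarrow> in_nbrs D u \<inter> S \<noteq> in_nbrs D v \<inter> S)"

definition gamma_LD :: "'a pair_pre_digraph \<Rightarrow> nat" where
  "gamma_LD D = Min {card S | S. locating_dominating D S}"

definition Gamma_LD :: "'a pair_pre_digraph \<Rightarrow> nat" where
  "Gamma_LD G = Max {gamma_LD D | D. orientation G D}"

text \<open>
  For a finite simple graph the extrema above range over nonempty sets, finite in the case of
  \<open>Min\<close> and \<open>Max\<close>.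
\<close>

lemma finite_subset_cards:
  assumes "finite V" and "\<And>S. P S \<Longrightarrow> S \<subseteq> V"
  shows "finite {card S | S. P S}"
proof -
  have "{card S | S. P S} \<subseteq> card ` Pow V"
    using assms(2) by blast
  then show ?thesis
    by (rule finite_subset) (simp add: assms(1))
qed

context pair_graph
begin

lemma ex_proper_colouring: "\<exists>k f. proper_colouring G k f"
proof -
  obtain f :: "'a \<Rightarrow> nat" and n where f: "f ` pverts G = {i. i < n}" "inj_on f (pverts G)"
    using finite_imp_inj_to_nat_seg[OF pair_finite_verts] by blast
  have "proper_colouring G n f"
    unfolding proper_colouring_def
  proof (intro conjI)
    show "\<forall>(u, v)\<in>parcs G. f u \<noteq> f v"
      using f(2) pair_no_loops by (fastforce dest: inj_onD in_arcsD1 in_arcsD2)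
  qed (use f(1) in auto)
  then show ?thesis by blast
qed

lemma clique_cards: "finite {card C | C. clique G C}" "{card C | C. clique G C} \<noteq> {}"
proof -
  show "finite {card C | C. clique G C}"
    by (rule finite_subset_cards[OF pair_finite_verts]) (simp add: clique_def)
  have "clique G {}" by (simp add: clique_def)
  then show "{card C | C. clique G C} \<noteq> {}" by blast
qed

lemma locating_dominating_cards:
  assumes "orientation G D"
  shows "finite {card S | S. locating_dominating D S}" "{card S | S. locating_dominating D S} \<noteq> {}"
proof -
  have "finite (pverts D)"
    using assms pair_finite_verts by (simp add: orientation_def)
  then show "finite {card S | S. locating_dominating D S}"
    by (rule finite_subset_cards) (simp add: locating_dominating_def)
  have "locating_dominating D (pverts D)" by (simp add: locating_dominating_def)
  then show "{card S | S. locating_dominating D S} \<noteq> {}" by blast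
qed

lemma orientation_gammas:
  "finite {gamma_LD D | D. orientation G D}" "{gamma_LD D | D. orientation G D} \<noteq> {}"
proof -
  have "{gamma_LD D | D. orientation G D} \<subseteq>
      (\<lambda>A. gamma_LD \<lparr>pverts = pverts G, parcs = A\<rparr>) ` Pow (parcs G)"
  proof clarify
    fix D assume D: "orientation G D"
    then have "D = \<lparr>pverts = pverts G, parcs = parcs D\<rparr>" "parcs D \<in> Pow (parcs G)"
      by (auto simp: orientation_def)
    then show "gamma_LD D \<in> (\<lambda>A. gamma_LD \<lparr>pverts = pverts G, parcs = A\<rparr>) ` Pow (parcs G)"
      by (metis image_eqI)
  qed
  then show "finite {gamma_LD D | D. orientation G D}"
    by (rule finite_subset) (simp add: pair_finite_arcs)
  obtain k f where f: "proper_colouring G k f"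
    using ex_proper_colouring by blast
  have sym: "(v, u) \<in> parcs G" if "(u, v) \<in> parcs G" for u v
    using that pair_sym_arcs by (auto simp: symmetric_def sym_def)
  have "f u < f v \<or> f v < f u" if "(u, v) \<in> parcs G" for u v
    using f that by (auto simp: proper_colouring_def neq_iff)
  then have "orientation G \<lparr>pverts = pverts G, parcs = {(u, v) \<in> parcs G. f u < f v}\<rparr>"
    using sym by (auto simp: orientation_def)
  then show "{gamma_LD D | D. orientation G D} \<noteq> {}" by blast
qed

end

end

theory Submission
  imports Defs
begin

text \<open>
  Orient every edge upwards along an injective ranking of the vertices in which a given set \<open>K\<close>
  comes first. If \<open>K\<close> is independent, then its vertices become sources and lie in every
  locating-dominating set \<open>S\<close>. If \<open>K\<close> is a clique, then the in-neighbourhoods in \<open>S\<close> of the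
  vertices of \<open>K - S\<close> form a chain of distinct nonempty subsets of \<open>S\<close>, so \<open>|K - S| \<le> |S \<inter> K|\<close>.
  Hence \<open>\<alpha> \<le> \<Gamma>\<close> and \<open>\<omega> \<le> 2 \<Gamma>\<close>, and \<open>n \<le> \<chi> \<alpha> \<le> \<omega>\<^sup>c \<alpha> \<le> (2 \<Gamma>)\<^sup>c \<Gamma>\<close>.
\<close>

definition rank_orientation :: "'a pair_pre_digraph \<Rightarrow> ('a \<Rightarrow> nat) \<Rightarrow> 'a pair_pre_digraph" where
  "rank_orientation G f = \<lparr>pverts = pverts G, parcs = {(u, v) \<in> parcs G. f u < f v}\<rparr>"

lemma pverts_rank_orientation [simp]: "pverts (rank_orientation G f) = pverts G"
  by (simp add: rank_orientation_def)

lemma in_nbrs_rank_orientation: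
  "in_nbrs (rank_orientation G f) v = {u. (u, v) \<in> parcs G \<and> f u < f v}"
  by (simp add: in_nbrs_def rank_orientation_def)

lemma ex_ranking_initial:
  assumes "finite V" "K \<subseteq> V"
  obtains f :: "'a \<Rightarrow> nat" where "inj_on f V" "\<And>u v. u \<in> K \<Longrightarrow> v \<in> V - K \<Longrightarrow> f u < f v"
proof -
  obtain g :: "'a \<Rightarrow> nat" and n where g: "g ` V = {i. i < n}" "inj_on g V"
    using finite_imp_inj_to_nat_seg[OF assms(1)] by blast
  have lt: "g v < n" if "v \<in> V" for v
    using g(1) that by blast
  \<comment> \<open>Adding \<open>n\<close> lifts all ranks outside \<open>K\<close> above every
    value of \<open>g\<close>, so \<open>K\<close> comes first and injectivity survives.\<close>
  define f where "f = (\<lambda>v. if v \<in> K then g v else n + g v)"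
  show thesis
  proof
    show "inj_on f V"
      using g(2) lt by (fastforce simp: inj_on_def f_def)
    show "f u < f v" if "u \<in> K" "v \<in> V - K" for u v
      using that assms(2) lt[of u] by (auto simp: f_def)
  qed
qed

context pair_graph
begin

lemma orientation_rank_orientation:
  assumes "inj_on f (pverts G)"
  shows "orientation G (rank_orientation G f)"
proof -
  have sym: "(v, u) \<in> parcs G" if "(u, v) \<in> parcs G" for u v
    using that pair_sym_arcs by (auto simp: symmetric_def sym_def)
  have "f u < f v \<or> f v < f u" if "(u, v) \<in> parcs G" for u v
    using inj_onD[OF assms, of u v] pair_no_loops[OF that] in_arcsD1[OF that] in_arcsD2[OF that]
    by (metis fst_conv snd_conv linorder_neqE_nat)
  with sym show ?thesis
    by (auto simp: orientation_def rank_orientation_def)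
qed

text \<open>\<open>gamma_LD D\<close> is attained by some \<open>S\<close>, and
  \<open>Gamma_LD G\<close> is a maximum over orientations, so one well-chosen orientation suffices.
  The factor \<open>r\<close> is 1 for independent sets and 2 for cliques.\<close>

lemma le_Gamma_LD:
  assumes "orientation G D" "\<And>S. locating_dominating D S \<Longrightarrow> m \<le> r * card S"
  shows "m \<le> r * Gamma_LD G"
proof -
  have "gamma_LD D \<in> {card S | S. locating_dominating D S}"
    unfolding gamma_LD_def by (rule Min_in[OF locating_dominating_cards[OF assms(1)]])
  then have "m \<le> r * gamma_LD D"
    using assms(2) by auto
  moreover have "gamma_LD D \<le> Gamma_LD G"
    unfolding Gamma_LD_def using assms(1) by (intro Max_ge orientation_gammas) auto
  ultimately show ?thesis
    using mult_le_mono2 order_trans by blast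
qed

lemma card_independent_le_Gamma_LD:
  assumes "I \<subseteq> pverts G" "\<And>u v. u \<in> I \<Longrightarrow> v \<in> I \<Longrightarrow> (u, v) \<notin> parcs G"
  shows "card I \<le> Gamma_LD G"
proof -
  obtain f :: "'a \<Rightarrow> nat" where
    f: "inj_on f (pverts G)" "\<And>u v. u \<in> I \<Longrightarrow> v \<in> pverts G - I \<Longrightarrow> f u < f v"
    using ex_ranking_initial[OF pair_finite_verts assms(1)] by blast
  have "card I \<le> 1 * Gamma_LD G"
  proof (rule le_Gamma_LD[OF orientation_rank_orientation[OF f(1)]])
    fix S assume S: "locating_dominating (rank_orientation G f) S"
    have "in_nbrs (rank_orientation G f) v = {}" if "v \<in> I" for v
    proof -
      \<comment> \<open>A lower-ranked neighbour of \<open>v\<close> would itself lie in the initial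
        set \<open>I\<close>, against independence.\<close>
      have "\<not> f u < f v" if uv: "(u, v) \<in> parcs G" for u
        using assms(2) f(2) \<open>v \<in> I\<close> uv in_arcsD1[OF uv] by (metis DiffI order.asym)
      then show ?thesis
        by (auto simp: in_nbrs_rank_orientation)
    qed
    moreover have SV: "S \<subseteq> pverts G"
      using S by (simp add: locating_dominating_def)
    moreover have "in_nbrs (rank_orientation G f) v \<noteq> {}" if "v \<in> pverts G - S" for v
      using S that by (auto simp: locating_dominating_def)
    \<comment> \<open>A source cannot be dominated from outside itself, so it must belong to
      \<open>S\<close>.\<close>
    ultimately have "I \<subseteq> S"
      using assms(1) by blast
    moreover have "finite S"
      using finite_subset[OF SV pair_finite_verts] .
    ultimately show "card I \<le> 1 * card S"
      by (simp add: card_mono)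
  qed
  then show ?thesis by simp
qed

lemma card_clique_le_Gamma_LD:
  assumes "clique G K"
  shows "card K \<le> 2 * Gamma_LD G"
proof -
  have K: "K \<subseteq> pverts G" "\<And>u v. u \<in> K \<Longrightarrow> v \<in> K \<Longrightarrow> u \<noteq> v \<Longrightarrow> (u, v) \<in> parcs G"
    using assms by (auto simp: clique_def)
  obtain f :: "'a \<Rightarrow> nat" where
    f: "inj_on f (pverts G)" "\<And>u v. u \<in> K \<Longrightarrow> v \<in> pverts G - K \<Longrightarrow> f u < f v"
    using ex_ranking_initial[OF pair_finite_verts K(1)] by blast
  let ?D = "rank_orientation G f"
  show ?thesis
  proof (rule le_Gamma_LD[OF orientation_rank_orientation[OF f(1)]])
    fix S assume S: "locating_dominating ?D S"
    then have "S \<subseteq> pverts G"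
      by (simp add: locating_dominating_def)
    then have fin: "finite S" "finite K"
      using finite_subset[OF _ pair_finite_verts] K(1) by blast+
    define N where "N v = in_nbrs ?D v \<inter> S" for v
    have dom: "N v \<noteq> {}" if "v \<in> K - S" for v
      using S K(1) that by (auto simp: locating_dominating_def N_def)
    have loc: "N u \<noteq> N v" if "u \<in> K - S" "v \<in> K - S" "u \<noteq> v" for u v
      using S K(1) that by (simp add: locating_dominating_def N_def subset_iff)
    \<comment> \<open>In-neighbours of \<open>v\<close> rank below \<open>v\<close>, hence lie in
      the initial set \<open>K\<close>; conversely, the clique makes every lower-ranked vertex of
      \<open>K\<close> an in-neighbour. So each \<open>N v\<close> is an initial segment of
      \<open>S \<inter> K\<close>.\<close>
    have N_eq: "N v = {w \<in> S \<inter> K. f w < f v}" if "v \<in> K" for v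
    proof -
      have "w \<in> K" if "(w, v) \<in> parcs G" "f w < f v" for w
        using f(2)[OF \<open>v \<in> K\<close>] that in_arcsD1[OF that(1)] by (metis DiffI order.asym)
      moreover have "(w, v) \<in> parcs G" if "w \<in> K" "f w < f v" for w
        using K(2) \<open>v \<in> K\<close> that by blast
      ultimately show ?thesis
        by (auto simp: N_def in_nbrs_rank_orientation)
    qed
    \<comment> \<open>Initial segments are nested, so equal size would force equal sets, which
      location forbids.\<close>
    have "inj_on (\<lambda>v. card (N v)) (K - S)"
    proof (rule inj_onI, rule ccontr)
      fix u v assume uv: "u \<in> K - S" "v \<in> K - S" "card (N u) = card (N v)" "u \<noteq> v"
      have "finite (N u)" "finite (N v)"
        using fin(1) by (simp_all add: N_def)
      moreover have "N u \<subseteq> N v \<or> N v \<subseteq> N u"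
        using uv by (auto simp: N_eq)
      ultimately have "N u = N v"
        using uv(3) by (metis card_subset_eq)
      with loc uv show False by blast
    qed
    \<comment> \<open>Domination excludes size 0; this keeps the final bound at
      \<open>2 * card S\<close> with no additive 1.\<close>
    moreover have "(\<lambda>v. card (N v)) ` (K - S) \<subseteq> {1..card (S \<inter> K)}"
      using fin dom by (fastforce simp: N_eq Suc_le_eq card_gt_0_iff intro!: card_mono)
    ultimately have "card (K - S) \<le> card (S \<inter> K)"
      using card_inj_on_le[of _ "K - S" "{1..card (S \<inter> K)}"] by simp
    moreover have "card K = card (K - S) + card (S \<inter> K)"
      using card_Int_Diff[OF fin(2), of S] by (simp add: Int_commute)
    moreover have "card (S \<inter> K) \<le> card S"
      using fin(1) by (simp add: card_mono)
    ultimately show "card K \<le> 2 * card S" by simp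
  qed
qed

lemma clique_number_le_Gamma_LD: "clique_number G \<le> 2 * Gamma_LD G"
  using Max_in[OF clique_cards] card_clique_le_Gamma_LD by (auto simp: clique_number_def)

text \<open>Colour classes are independent, so the bound for independent sets applies to each class
  of an optimal colouring.\<close>

lemma card_verts_le_chromatic_number_Gamma_LD:
  "card (pverts G) \<le> chromatic_number G * Gamma_LD G"
proof -
  let ?k = "chromatic_number G"
  obtain f where f: "proper_colouring G ?k f"
    unfolding chromatic_number_def using LeastI_ex[OF ex_proper_colouring] by blast
  have "card (pverts G) = card (\<Union>i<?k. {v \<in> pverts G. f v = i})"
    using f by (intro arg_cong[where f = card]) (auto simp: proper_colouring_def)
  also have "\<dots> \<le> (\<Sum>i<?k. card {v \<in> pverts G. f v = i})"
    by (rule card_UN_le) simp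
  also have "\<dots> \<le> (\<Sum>i<?k. Gamma_LD G)"
    using f by (intro sum_mono card_independent_le_Gamma_LD) (auto simp: proper_colouring_def)
  finally show ?thesis by simp
qed

end

theorem theorem41:
  fixes c :: real and \<G> :: "'a pair_pre_digraph set"
  assumes "c \<ge> 0"
    and "\<And>G. G \<in> \<G> \<Longrightarrow> pair_graph G"
    and "\<And>G. G \<in> \<G> \<Longrightarrow> real (chromatic_number G) \<le> real (clique_number G) powr c"
  shows "\<forall>G \<in> \<G>. \<forall>n. card (pverts G) = n \<longrightarrow>
    real (Gamma_LD G) \<ge> 2 powr (- c / (c + 1)) * real n powr (1 / (c + 1))"
proof (intro ballI allI impI)
  fix G n assume G: "G \<in> \<G>" and n: "card (pverts G) = n"
  interpret pair_graph G by (rule assms(2)[OF G])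
  let ?g = "real (Gamma_LD G)"
  have "real n \<le> real (chromatic_number G) * ?g"
    using card_verts_le_chromatic_number_Gamma_LD n by (metis of_nat_le_iff of_nat_mult)
  also have "\<dots> \<le> (2 * ?g) powr c * ?g"
  proof (rule mult_right_mono)
    have "real (clique_number G) powr c \<le> (2 * ?g) powr c"
      using clique_number_le_Gamma_LD assms(1) by (intro powr_mono2) linarith+
    with assms(3)[OF G] show "real (chromatic_number G) \<le> (2 * ?g) powr c"
      by linarith
  qed simp
  \<comment> \<open>This covers \<open>?g = 0\<close> too, because \<open>0 powr x = 0\<close> for
    every \<open>x\<close>, including \<open>x = 0\<close>.\<close>
  also have "\<dots> = 2 powr c * ?g powr (c + 1)"
    by (simp add: powr_mult powr_add)
  finally have "real n powr (1 / (c + 1)) \<le> (2 powr c * ?g powr (c + 1)) powr (1 / (c + 1))"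
    using assms(1) by (intro powr_mono2) auto
  also have "\<dots> = 2 powr (c / (c + 1)) * ?g"
    using assms(1) by (simp add: powr_mult powr_powr)
  \<comment> \<open>Multiplying by the inverse of \<open>2 powr (c / (c + 1))\<close> isolates
    \<open>?g\<close>.\<close>
  finally have "2 powr (- c / (c + 1)) * real n powr (1 / (c + 1))
      \<le> 2 powr (- c / (c + 1)) * (2 powr (c / (c + 1)) * ?g)"
    by (rule mult_left_mono) simp
  also have "\<dots> = ?g"
    by (simp add: mult.assoc[symmetric] powr_add[symmetric])
  finally show "2 powr (- c / (c + 1)) * real n powr (1 / (c + 1)) \<le> ?g" .
qed

end
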